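(* Every shifted cubical complex is Laplacian integral; that is, if $X\subseteq Q_n$ is a shifted cubical complex, then all eigenvalues of all the Laplacians $L^{\rm ud}_{X,i}$, $L^{\rm du}_{X,i}$, $L^{\rm tot}_{X,i}$ ($0\le i\le\dim X$) are integers.
   Context: The $n$-cube $Q_n$ is the poset of $n$-tuples $f=(f_1,\dots,f_n)$ with $f_i\in\{0,1,\circledast\}$, ordered by $f\le g$ iff $f_i\le g_i$ for all $i$, where $0<\circledast$, $1<\circledast$, and $0,1$ are incomparable. $\mathrm{dir}(f)=\{i : f_i=\circledast\}$ and $\dim f=|\mathrm{dir}(f)|$. A proper cubical complex is an order ideal $X$ of $Q_n$; $X_i$ is its set of $i$-dimensional faces (there is no $(-1)$-dimensional face). A shifted cubical complex is a proper cubical complex $X\subseteq Q_n$ such that, for every $f,g\in\{0,1,\circledast\}^n$ with $\dim f=\dim g$: (1) $X$ contains the full $1$-skeleton of $Q_n$; (2) if $f\in X$ and $\mathrm{dir}(f)=\mathrm{dir}(g)$, then $g\in X$; (3) if $g\in X$ and $\mathrm{dir}(f)$ precedes $\mathrm{dir}(g)$ in component-wise partial order (i.e. for every $i$ the $i$-th smallest element of $\mathrm{dir}(f)$ is less than or equal to the $i$-th smallest element of $\mathrm{dir}(g)$), then $f\in X$. For $f\le g$ with $\dim f=i-1$, $\dim g=i$, write $\mathrm{dir}(g)=\{a_1<\dots<a_i\}$ and $\mathrm{dir}(f)=\mathrm{dir}(g)\setminus\{a_j\}$; put $\varepsilon(f,g)=(-1)^j$ if $f_{a_j}=0$ and $\varepsilon(f,g)=(-1)^{j+1}$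 if $f_{a_j}=1$. If $f\not\le g$, put $\varepsilon(f,g)=0$. The boundary map is $\partial_{X,i}\colon C_i(X)\to C_{i-1}(X)$, $[g]\mapsto\sum_{f\in X_{i-1}}\varepsilon(f,g)[f]$, where $C_i(X)$ is the free module on $X_i$ and $\partial_{X,0}=0$; $\partial^*_{X,i}$ is its transpose. The Laplacians on $C_i(X)$ are $L^{\rm ud}_{X,i}=\partial_{X,i+1}\partial^*_{X,i+1}$, $L^{\rm du}_{X,i}=\partial^*_{X,i}\partial_{X,i}$, $L^{\rm tot}_{X,i}=L^{\rm ud}_{X,i}+L^{\rm du}_{X,i}$. *)

theory Defs
  imports "Jordan_Normal_Form.Char_Poly"
begin

datatype coord = C0 | C1 | Star

type_synonym face = "coord list"

definition coord_le :: "coord \<Rightarrow> coord \<Rightarrow> bool" where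
  "coord_le a b \<longleftrightarrow> a = b \<or> b = Star"

definition face_le :: "face \<Rightarrow> face \<Rightarrow> bool" where
  "face_le f g \<longleftrightarrow> list_all2 coord_le f g"

definition cube :: "nat \<Rightarrow> face set" where
  "cube n = {f. length f = n}"

(* Directions are numbered 0, ..., n - 1 rather than 1, ..., n; only their relative
   order matters below. *)
definition dir :: "face \<Rightarrow> nat set" where
  "dir f = {a. a < length f \<and> f ! a = Star}"

definition face_dim :: "face \<Rightarrow> nat" where
  "face_dim f = card (dir f)"

definition proper_cubical_complex :: "nat \<Rightarrow> face set \<Rightarrow> bool" where
  "proper_cubical_complex n X \<longleftrightarrow>
     X \<subseteq> cube n \<and> (\<forall>g\<in>X. \<forall>f\<in>cube n. face_le f g \<longrightarrow> f \<in> X)"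

definition complex_dim :: "face set \<Rightarrow> nat" where
  "complex_dim X = Max (face_dim ` X)"

definition precedes :: "nat set \<Rightarrow> nat set \<Rightarrow> bool" where
  "precedes A B \<longleftrightarrow> list_all2 (\<le>) (sorted_list_of_set A) (sorted_list_of_set B)"

definition shifted_cubical_complex :: "nat \<Rightarrow> face set \<Rightarrow> bool" where
  "shifted_cubical_complex n X \<longleftrightarrow>
     proper_cubical_complex n X \<and>
     (\<forall>f\<in>cube n. face_dim f \<le> 1 \<longrightarrow> f \<in> X) \<and>
     (\<forall>f\<in>cube n. \<forall>g\<in>cube n. face_dim f = face_dim g \<longrightarrow>
        f \<in> X \<longrightarrow> dir f = dir g \<longrightarrow> g \<in> X) \<and>
     (\<forall>f\<in>cube n. \<forall>g\<in>cube n. face_dim f = face_dim g \<longrightarrow>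
        g \<in> X \<longrightarrow> precedes (dir f) (dir g) \<longrightarrow> f \<in> X)"

(* The set X_i of i-dimensional faces of a complex X in the n-cube, listed in a fixed
   (lexicographic) order; this order indexes the rows and columns of the matrices below. *)
definition face_list :: "nat \<Rightarrow> face set \<Rightarrow> nat \<Rightarrow> face list" where
  "face_list n X i =
     filter (\<lambda>f. f \<in> X \<and> face_dim f = i) (List.n_lists n [C0, C1, Star])"

lemma distinct_face_list: "distinct (face_list n X i)"
  by (simp add: face_list_def distinct_n_lists)

lemma set_face_list:
  assumes "proper_cubical_complex n X"
  shows "set (face_list n X i) = {f \<in> X. face_dim f = i}"
proof -
  have "set [C0, C1, Star] = UNIV"
    using coord.exhaust by auto
  then have "set (List.n_lists n [C0, C1, Star]) = cube n"
    unfolding set_n_lists cube_def by auto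
  with assms show ?thesis
    by (auto simp: face_list_def proper_cubical_complex_def)
qed

(* Meant for faces with face_dim g = face_dim f + 1. Then face_le f g implies that
   dir g - dir f has exactly one element a, and if a is the j-th smallest element of
   dir g (counting from 1), then j is the cardinality below. *)
definition incidence :: "face \<Rightarrow> face \<Rightarrow> int" where
  "incidence f g =
     (if face_le f g then
        let a = (THE a. a \<in> dir g - dir f); j = card {b \<in> dir g. b \<le> a}
        in if f ! a = C0 then (- 1) ^ j else (- 1) ^ (j + 1)
      else 0)"

(* Matrix of the boundary map from C_i(X) to C_{i-1}(X). As there is no face of dimension
   -1, it has no rows for i = 0. *)
fun boundary_mat :: "nat \<Rightarrow> face set \<Rightarrow> nat \<Rightarrow> 'a :: comm_ring_1 mat" where
  "boundary_mat n X 0 = 0\<^sub>m 0 (length (face_list n X 0))"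
| "boundary_mat n X (Suc i) =
     mat (length (face_list n X i)) (length (face_list n X (Suc i)))
       (\<lambda>(r, c). of_int (incidence (face_list n X i ! r) (face_list n X (Suc i) ! c)))"

definition laplacian_ud :: "nat \<Rightarrow> face set \<Rightarrow> nat \<Rightarrow> 'a :: comm_ring_1 mat" where
  "laplacian_ud n X i = boundary_mat n X (i + 1) * transpose_mat (boundary_mat n X (i + 1))"

definition laplacian_du :: "nat \<Rightarrow> face set \<Rightarrow> nat \<Rightarrow> 'a :: comm_ring_1 mat" where
  "laplacian_du n X i = transpose_mat (boundary_mat n X i) * boundary_mat n X i"

definition laplacian_tot :: "nat \<Rightarrow> face set \<Rightarrow> nat \<Rightarrow> 'a :: comm_ring_1 mat" where
  "laplacian_tot n X i = laplacian_ud n X i + laplacian_du n X i"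

(* Eigenvalues are taken over the complex numbers, so that every root of the
   characteristic polynomial counts. *)
definition laplacian_integral :: "nat \<Rightarrow> face set \<Rightarrow> bool" where
  "laplacian_integral n X \<longleftrightarrow>
     (\<forall>i \<le> complex_dim X. \<forall>k :: complex.
        eigenvalue (laplacian_ud n X i) k \<or>
        eigenvalue (laplacian_du n X i) k \<or>
        eigenvalue (laplacian_tot n X i) k \<longrightarrow> k \<in> \<int>)"

end

theory Submission
  imports Defs
begin

text \<open>
  Everything reduces to the up-down Laplacian. A nonzero eigenvalue of \<open>M\<^sup>T M\<close> is one of
  \<open>M M\<^sup>T\<close>, so the down-up Laplacian in dimension \<open>i + 1\<close> shares its nonzero spectrum with the
  up-down Laplacian in dimension \<open>i\<close>. Since the boundary of a boundary vanishes, the product of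
  the up-down and the down-up Laplacian is zero, and therefore every eigenvalue of their sum is
  an eigenvalue of one of them.

  The up-down Laplacian in dimension \<open>i\<close> depends only on the family \<open>F\<close> of faces of dimension
  \<open>i + 1\<close>: it is \<open>L\<^sub>F = \<partial> p \<partial>\<^sup>*\<close>, where \<open>\<partial>\<close> is the boundary map of the whole cube and \<open>p\<close> the
  coordinate projection to the span of \<open>F\<close>. The heart of the proof
  (\<open>lap_eigenvalue_integral\<close>) is an induction on \<open>n\<close> that splits off the first coordinate, the
  smallest direction. Let \<open>A\<close> (the link) consist of the \<open>g\<close> with \<open>Star # g \<in> F\<close> and \<open>B\<close> (the
  deletion) of the \<open>g\<close> with \<open>C0 # g \<in> F\<close>, equivalently \<open>C1 # g \<in> F\<close>. Shiftedness passes to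
  \<open>A\<close> and \<open>B\<close>, and it makes every facet of a face in \<open>B\<close> a member of \<open>A\<close>: replacing a direction
  by the smallest one goes down in the component-wise order.

  A chain on the larger cube has three parts, \<open>x\<^sub>0\<close>, \<open>x\<^sub>1\<close> and \<open>y\<close>, for the values \<open>C0\<close>, \<open>C1\<close>,
  \<open>Star\<close> of the first coordinate. Put \<open>s = x\<^sub>0 + x\<^sub>1\<close>, \<open>x = x\<^sub>1 - x\<^sub>0\<close>, and let \<open>p\<close> now be the
  projection to the span of \<open>A\<close>. An eigenvector for \<open>k \<noteq> 0\<close> satisfies
    \<open>k s = L\<^sub>B s\<close>,  \<open>k x = L\<^sub>B x + 2 p (x - \<partial>\<^sup>* y)\<close>,  \<open>k y = L\<^sub>A y - \<partial> p x\<close>.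
  If \<open>s\<close> is nonzero, \<open>k\<close> is an eigenvalue of \<open>L\<^sub>B\<close>. Otherwise, as \<open>L\<^sub>B x\<close> is supported on \<open>A\<close>, so
  is \<open>x\<close>. Applying \<open>\<partial>\<close> to the second equation kills \<open>L\<^sub>B x\<close>, and eliminating \<open>\<partial> x\<close> by the third
  leaves \<open>L\<^sub>A y = (k - 2) y\<close>. If \<open>y = 0\<close>, the second equation reads \<open>L\<^sub>B x = (k - 2) x\<close>. So
  \<open>k\<close> or \<open>k - 2\<close> is an eigenvalue for a smaller cube, hence an integer.
\<close>

section \<open>Incidence numbers by recursion on the first coordinate\<close>

text \<open>
  The first coordinate is the smallest direction, so removing it means \<open>j = 1\<close>, which gives
  the signs \<open>- 1\<close> for \<open>C0\<close> and \<open>1\<close> for \<open>C1\<close>; a common \<open>Star\<close> in front moves the removed direction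
  up by one position and so flips the sign.
\<close>

fun inc :: "face \<Rightarrow> face \<Rightarrow> int" where
  "inc (a # f) (b # g) =
     (if a = b then (if a = Star then - inc f g else inc f g)
      else if b = Star \<and> f = g then (if a = C0 then - 1 else 1) else 0)"
| "inc _ _ = 0"

lemma dir_Nil [simp]: "dir [] = {}"
  by (simp add: dir_def)

lemma dir_Cons: "dir (a # f) = (if a = Star then insert 0 (Suc ` dir f) else Suc ` dir f)"
proof (rule Set.set_eqI)
  fix x
  show "x \<in> dir (a # f) \<longleftrightarrow> x \<in> (if a = Star then insert 0 (Suc ` dir f) else Suc ` dir f)"
    by (cases x) (auto simp: dir_def)
qed

lemma finite_dir [simp]: "finite (dir f)"
  by (simp add: dir_def)

lemma face_dim_Nil [simp]: "face_dim [] = 0"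
  by (simp add: face_dim_def)

lemma face_dim_Cons [simp]:
  "face_dim (a # f) = (if a = Star then Suc (face_dim f) else face_dim f)"
  by (auto simp: face_dim_def dir_Cons card_image card_insert_if)

lemma face_le_Nil [simp]: "face_le [] []"
  by (simp add: face_le_def)

lemma face_le_Cons [simp]: "face_le (a # f) (b # g) \<longleftrightarrow> (a = b \<or> b = Star) \<and> face_le f g"
  by (auto simp: face_le_def coord_le_def)

lemma face_le_refl: "face_le f f"
  by (induction f) auto

lemma face_le_length: "face_le f g \<Longrightarrow> length f = length g"
  by (simp add: face_le_def list_all2_lengthD)

lemma face_le_dir_subset: "face_le f g \<Longrightarrow> dir f \<subseteq> dir g"
  unfolding dir_def face_le_def by (auto simp: list_all2_conv_all_nth coord_le_def)

lemma face_le_eq_dim: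
  assumes "face_le f g" "face_dim f = face_dim g"
  shows "f = g"
proof -
  have "dir f = dir g"
    using assms face_le_dir_subset by (simp add: card_subset_eq face_dim_def)
  then have "i < length g \<Longrightarrow> g ! i = Star \<Longrightarrow> f ! i = Star" for i
    by (auto simp: dir_def)
  then show ?thesis
    using assms(1) by (intro nth_equalityI)
      (auto simp: face_le_def list_all2_conv_all_nth coord_le_def)
qed

lemma inc_nonzeroD:
  assumes "inc f g \<noteq> 0"
  shows "face_le f g \<and> face_dim g = Suc (face_dim f)"
  using assms
proof (induction f g rule: inc.induct)
  case (1 a f b g)
  then show ?case by (auto split: if_splits simp: face_le_refl)
qed auto

lemma incidence_removed_direction:
  assumes "face_le f g" "dir g - dir f = {a}"
  shows "incidence f g = (if f ! a = C0 then (- 1) ^ card {b \<in> dir g. b \<le> a}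
                          else (- 1) ^ (card {b \<in> dir g. b \<le> a} + 1))"
  using assms by (simp add: incidence_def)

lemma card_Suc_image_le: "card {b \<in> Suc ` D. b \<le> Suc a} = card {b \<in> D. b \<le> a}"
proof -
  have "{b \<in> Suc ` D. b \<le> Suc a} = Suc ` {b \<in> D. b \<le> a}" by auto
  then show ?thesis by (simp add: card_image)
qed

text \<open>
  The bridge to the closed formula. The hypothesis on dimensions is essential: the closed formula is
  meaningful only when exactly one direction is removed, whereas \<open>inc\<close> vanishes in all other cases.
\<close>

lemma incidence_eq_inc:
  assumes "length f = length g" "face_dim g = Suc (face_dim f)"
  shows "incidence f g = inc f g"
  using assms
proof (induction f g rule: inc.induct)
  case (1 a f b g)
  show ?case
  proof (cases "face_le (a # f) (b # g)")
    case False
    then have "inc (a # f) (b # g) = 0" using inc_nonzeroD by blast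
    then show ?thesis using False unfolding incidence_def if_not_P[OF False] by simp
  next
    case le: True
    then have le': "face_le f g" by simp
    show ?thesis
    proof (cases "a = b")
      case True
      have dim: "face_dim g = Suc (face_dim f)" using 1 True by (simp split: if_splits)
      have "card (dir g - dir f) = 1"
        using face_le_dir_subset[OF le'] dim by (simp add: card_Diff_subset face_dim_def)
      then obtain x where x: "dir g - dir f = {x}" by (auto simp: card_1_singleton_iff)
      have x': "dir (b # g) - dir (a # f) = {Suc x}"
        using x True by (auto simp: dir_Cons)
      have IH: "incidence f g = inc f g"
        using 1 True dim by (auto split: if_splits)
      have card: "card {y \<in> dir (b # g). y \<le> Suc x} =
          (if b = Star then 1 else 0) + card {y \<in> dir g. y \<le> x}"
      proof (cases "b = Star")
        case True
        have "{y \<in> dir (b # g). y \<le> Suc x} = insert 0 {y \<in> Suc ` dir g. y \<le> Suc x}"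
          using True by (auto simp: dir_Cons)
        then show ?thesis using True by (simp add: card_Suc_image_le)
      qed (simp add: dir_Cons card_Suc_image_le)
      show ?thesis
        using IH True unfolding incidence_removed_direction[OF le x']
          incidence_removed_direction[OF le' x] card
        by (auto split: if_splits)
    next
      case False
      then have b: "b = Star" using le by simp
      then have "face_dim g = face_dim f" using 1 False by simp
      then have fg: "f = g" using face_le_eq_dim le' by simp
      have d: "dir (b # g) - dir (a # f) = {0}" using b False fg by (auto simp: dir_Cons)
      have "{y \<in> dir (b # g). y \<le> 0} = {0}" using b by (auto simp: dir_Cons)
      then have "card {y \<in> dir (b # g). y \<le> 0} = 1" by simp
      then show ?thesis
        using False b fg unfolding incidence_removed_direction[OF le d] by simp
    qed
  qed
qed auto

section \<open>Boundary, coboundary and Laplacian as operators on functions\<close>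

text \<open>
  Chains are functions on faces, and only their values on \<open>cube n\<close> count. Working on the whole cube,
  in all dimensions at once, leaves the recursion free of index sets that vary with the complex.
\<close>

definition bd :: "nat \<Rightarrow> (face \<Rightarrow> 'a::comm_ring_1) \<Rightarrow> face \<Rightarrow> 'a" where
  "bd n c f = (\<Sum>g\<in>cube n. of_int (inc f g) * c g)"

definition cobd :: "nat \<Rightarrow> (face \<Rightarrow> 'a::comm_ring_1) \<Rightarrow> face \<Rightarrow> 'a" where
  "cobd n c g = (\<Sum>f\<in>cube n. of_int (inc f g) * c f)"

definition restr :: "face set \<Rightarrow> (face \<Rightarrow> 'a::comm_ring_1) \<Rightarrow> face \<Rightarrow> 'a" where
  "restr F c g = (if g \<in> F then c g else 0)"

definition lap :: "nat \<Rightarrow> face set \<Rightarrow> (face \<Rightarrow> 'a::comm_ring_1) \<Rightarrow> face \<Rightarrow> 'a" where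
  "lap n F c = bd n (restr F (cobd n c))"

lemma cube_0 [simp]: "cube 0 = {[]}"
  by (auto simp: cube_def)

lemma Cons_in_cube [simp]: "a # f \<in> cube (Suc n) \<longleftrightarrow> f \<in> cube n"
  by (simp add: cube_def)

lemma cube_Suc: "cube (Suc n) = (#) C0 ` cube n \<union> (#) C1 ` cube n \<union> (#) Star ` cube n"
proof -
  have "a = C0 \<or> a = C1 \<or> a = Star" for a by (cases a) auto
  then show ?thesis by (auto simp: cube_def length_Suc_conv image_iff) 
qed

lemma cube_Suc_cases:
  assumes "f \<in> cube (Suc n)"
  obtains g where "f = C0 # g" "g \<in> cube n" | g where "f = C1 # g" "g \<in> cube n"
    | g where "f = Star # g" "g \<in> cube n"
  using assms unfolding cube_Suc by auto

lemma finite_cube [simp]: "finite (cube n)"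
  by (induction n) (simp_all add: cube_Suc)

lemma sum_cube_Suc:
  "(\<Sum>f\<in>cube (Suc n). h f) =
     (\<Sum>f\<in>cube n. h (C0 # f)) + (\<Sum>f\<in>cube n. h (C1 # f)) + (\<Sum>f\<in>cube n. h (Star # f))"
proof -
  have "((#) C0 ` cube n \<union> (#) C1 ` cube n) \<inter> (#) Star ` cube n = {}"
    and "(#) C0 ` cube n \<inter> (#) C1 ` cube n = {}" by auto
  then show ?thesis
    by (simp add: cube_Suc sum.union_disjoint sum.reindex)
qed

lemma bd_Cons:
  assumes "f \<in> cube n"
  shows "bd (Suc n) c (C0 # f) = bd n (\<lambda>g. c (C0 # g)) f - c (Star # f)"
    and "bd (Suc n) c (C1 # f) = bd n (\<lambda>g. c (C1 # g)) f + c (Star # f)"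
    and "bd (Suc n) c (Star # f) = - bd n (\<lambda>g. c (Star # g)) f"
  using assms
  by (simp_all add: bd_def sum_cube_Suc sum_negf if_distrib if_distribR sum.delta' cong: if_cong)

text \<open>
  The coboundary is the transpose of the boundary, so its three components are read off from the
  columns of the block matrix whose rows are given by \<open>bd_Cons\<close>.
\<close>

lemma cobd_Cons:
  assumes "g \<in> cube n"
  shows "cobd (Suc n) c (C0 # g) = cobd n (\<lambda>f. c (C0 # f)) g"
    and "cobd (Suc n) c (C1 # g) = cobd n (\<lambda>f. c (C1 # f)) g"
    and "cobd (Suc n) c (Star # g) = c (C1 # g) - c (C0 # g) - cobd n (\<lambda>f. c (Star # f)) g"
  using assms
  by (simp_all add: cobd_def sum_cube_Suc sum_negf if_distrib if_distribR sum.delta cong: if_cong)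

lemma bd_cong: "(\<And>g. g \<in> cube n \<Longrightarrow> c g = c' g) \<Longrightarrow> bd n c = bd n c'"
  by (auto simp: bd_def intro!: ext sum.cong)

lemma bd_linear:
  "bd n (\<lambda>g. c g + c' g) f = bd n c f + bd n c' f"
  "bd n (\<lambda>g. c g - c' g) f = bd n c f - bd n c' f"
  "bd n (\<lambda>g. - c g) f = - bd n c f"
  "bd n (\<lambda>g. t * c g) f = t * bd n c f"
  by (simp_all add: bd_def algebra_simps sum.distrib sum_subtractf sum_negf sum_distrib_left)

lemma cobd_linear:
  "cobd n (\<lambda>g. c g + c' g) f = cobd n c f + cobd n c' f"
  "cobd n (\<lambda>g. c g - c' g) f = cobd n c f - cobd n c' f"
  by (simp_all add: cobd_def algebra_simps sum.distrib sum_subtractf)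

lemma lap_linear:
  "lap n F (\<lambda>g. c g + c' g) f = lap n F c f + lap n F c' f"
  "lap n F (\<lambda>g. c g - c' g) f = lap n F c f - lap n F c' f"
  unfolding lap_def bd_linear(1,2)[symmetric]
  by (auto intro!: arg_cong[where f="\<lambda>c. bd n c f"] simp: restr_def cobd_linear)

text \<open>
  On the prism over a cube, the terms that meet the first direction cancel in pairs, and the others
  vanish by induction.
\<close>

lemma bd_bd: "f \<in> cube n \<Longrightarrow> bd n (bd n c) f = 0"
proof (induction n arbitrary: c f)
  case 0
  then show ?case by (simp add: bd_def)
next
  case (Suc n)
  have s: "bd n (\<lambda>g. bd (Suc n) c (Star # g)) = bd n (\<lambda>g. - bd n (\<lambda>g. c (Star # g)) g)"
    and z: "bd n (\<lambda>g. bd (Suc n) c (C0 # g)) = bd n (\<lambda>g. bd n (\<lambda>g. c (C0 # g)) g - c (Star # g))"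
    and o: "bd n (\<lambda>g. bd (Suc n) c (C1 # g)) = bd n (\<lambda>g. bd n (\<lambda>g. c (C1 # g)) g + c (Star # g))"
    by (intro bd_cong; simp add: bd_Cons)+
  from Suc.prems show ?case
    by (cases rule: cube_Suc_cases) (simp_all add: bd_Cons s z o bd_linear Suc.IH)
qed

section \<open>Shifted families of faces\<close>

text \<open>
  Reflexivity of \<open>precedes\<close> makes this one condition cover both exchanging \<open>C0\<close> and \<open>C1\<close> and
  lowering directions. It is a condition on a family of faces rather than on a complex because the
  induction applies it to the faces of a single dimension.
\<close>

definition shifted_family :: "nat \<Rightarrow> face set \<Rightarrow> bool" where
  "shifted_family n F \<longleftrightarrow>
     (\<forall>f\<in>cube n. \<forall>g\<in>F. precedes (dir f) (dir g) \<longrightarrow> f \<in> F)"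

lemma sorted_list_of_dir_Cons:
  "sorted_list_of_set (dir (a # f)) =
     (if a = Star then 0 # map Suc (sorted_list_of_set (dir f))
      else map Suc (sorted_list_of_set (dir f)))"
proof -
  have "sorted_wrt (<) (map Suc (sorted_list_of_set (dir f)))"
    by (simp add: sorted_wrt_map)
  then show ?thesis
    by (intro strict_sorted_equal) (auto simp: dir_Cons)
qed

lemma precedes_refl: "precedes A A"
  by (simp add: precedes_def list_all2_refl)

lemma precedes_dir_Cons_iff:
  "precedes (dir (a # f)) (dir (a # g)) \<longleftrightarrow> precedes (dir f) (dir g)"
  by (simp add: precedes_def sorted_list_of_dir_Cons list_all2_map1 list_all2_map2)

text \<open>
  Deleting an entry and prepending a lower bound moves the entries before the deleted one
  back by one place, so that each place receives a value at most its old one.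
\<close>

lemma sorted_list_remove1_cons_le:
  assumes "sorted xs" "a \<in> set xs" "\<forall>x\<in>set xs. z \<le> x"
  shows "list_all2 (\<le>) (z # remove1 a xs) xs"
  using assms by (induction xs arbitrary: z) (auto simp: list_all2_refl)

lemma inc_nonzero_precedes:
  assumes "inc f g \<noteq> 0" "b \<noteq> Star"
  shows "precedes (dir (Star # f)) (dir (b # g))"
proof -
  have le: "face_le f g" and dim: "face_dim g = Suc (face_dim f)"
    using inc_nonzeroD[OF assms(1)] by auto
  have sub: "dir f \<subseteq> dir g" using face_le_dir_subset[OF le] .
  have "card (dir g - dir f) = 1"
    using sub dim by (simp add: card_Diff_subset face_dim_def)
  then obtain x where x: "dir g - dir f = {x}" by (auto simp: card_1_singleton_iff)
  then have f: "dir f = dir g - {x}" and xg: "x \<in> dir g" using sub by auto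
  have "list_all2 (\<le>) (0 # remove1 (Suc x) (map Suc (sorted_list_of_set (dir g))))
          (map Suc (sorted_list_of_set (dir g)))"
    using xg by (intro sorted_list_remove1_cons_le) (auto simp: sorted_map)
  moreover have "remove1 (Suc x) (map Suc ys) = map Suc (remove1 x ys)" for ys
    by (induction ys) auto
  ultimately show ?thesis
    using assms(2) by (simp add: precedes_def sorted_list_of_dir_Cons f sorted_list_of_set_remove)
qed

lemma shifted_family_Cons:
  assumes "shifted_family (Suc n) F"
  shows "shifted_family n {g. a # g \<in> F}"
  unfolding shifted_family_def
proof (intro ballI impI)
  fix f g assume "f \<in> cube n" "g \<in> {g. a # g \<in> F}" "precedes (dir f) (dir g)"
  then have "a # f \<in> cube (Suc n)" "a # g \<in> F" "precedes (dir (a # f)) (dir (a # g))"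
    by (simp_all add: precedes_dir_Cons_iff)
  then show "f \<in> {g. a # g \<in> F}" using assms unfolding shifted_family_def by blast
qed

lemma shifted_family_C0_iff_C1:
  assumes "shifted_family (Suc n) F" "g \<in> cube n"
  shows "C0 # g \<in> F \<longleftrightarrow> C1 # g \<in> F"
proof -
  have "dir (C0 # g) = dir (C1 # g)" by (simp add: dir_Cons)
  then have "precedes (dir (C0 # g)) (dir (C1 # g))" "precedes (dir (C1 # g)) (dir (C0 # g))"
    by (simp_all add: precedes_refl)
  then show ?thesis using assms unfolding shifted_family_def
    by (meson Cons_in_cube)
qed

text \<open>
  The near-cone property of the smallest direction: the facets of the deletion lie in the link.
  It lets the boundary of the deletion pass unchanged through the projection to the link.
\<close>

lemma shifted_family_facet:
  assumes "shifted_family (Suc n) F" "f \<in> cube n" "C0 # g \<in> F" "inc f g \<noteq> 0"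
  shows "Star # f \<in> F"
proof -
  have "Star # f \<in> cube (Suc n)" using assms by simp
  then show ?thesis using assms inc_nonzero_precedes[OF assms(4), of C0]
    unfolding shifted_family_def by blast
qed

section \<open>Integrality of the up-down Laplacian\<close>

text \<open>
  The eigenvalue \<open>k = 0\<close> must be treated apart: the support of \<open>x\<close> and the elimination of its
  boundary are both obtained by dividing by \<open>k\<close>. Characteristic zero enters when \<open>s = 0\<close> and
  \<open>x = 0\<close> are to give \<open>x0 = x1 = 0\<close>.
\<close>

lemma lap_eigenvalue_integral:
  fixes k :: "'a::{idom,ring_char_0}"
  assumes "shifted_family n F" "\<And>f. f \<in> cube n \<Longrightarrow> lap n F c f = k * c f"
    and "\<exists>f\<in>cube n. c f \<noteq> 0"
  shows "k \<in> \<int>"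
  using assms
proof (induction n arbitrary: F c k)
  case 0
  then show ?case by (auto simp: lap_def bd_def)
next
  case (Suc n)
  show ?case
  proof (cases "k = 0")
    case False
    define A B where "A = {g. Star # g \<in> F}" and "B = {g. C0 # g \<in> F}"
    have shifted: "shifted_family n A" "shifted_family n B"
      unfolding A_def B_def using Suc.prems(1) by (rule shifted_family_Cons)+
    define x0 x1 y where "x0 = (\<lambda>f. c (C0 # f))" and "x1 = (\<lambda>f. c (C1 # f))"
      and "y = (\<lambda>f. c (Star # f))"
    define s x where "s = (\<lambda>f. x0 f + x1 f)" and "x = (\<lambda>f. x1 f - x0 f)"
    \<comment> \<open>The part of the coboundary on the faces \<open>Star # g\<close>; it enters the equations for \<open>x0\<close> and
      \<open>x1\<close> with opposite signs and therefore cancels in \<open>s\<close>.\<close>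
    define w where "w = restr A (\<lambda>g. x g - cobd n y g)"
    have w: "w = (\<lambda>g. restr A x g - restr A (cobd n y) g)"
      by (auto simp: w_def restr_def)
    have "bd n (\<lambda>g. restr F (cobd (Suc n) c) (C0 # g)) = lap n B x0"
      unfolding lap_def by (intro bd_cong) (auto simp: restr_def cobd_Cons B_def x0_def)
    moreover have "bd n (\<lambda>g. restr F (cobd (Suc n) c) (C1 # g)) = lap n B x1"
      unfolding lap_def using shifted_family_C0_iff_C1[OF Suc.prems(1)]
      by (intro bd_cong) (auto simp: restr_def cobd_Cons B_def x1_def)
    moreover have w_eq: "restr F (cobd (Suc n) c) (Star # g) = w g" if "g \<in> cube n" for g
      using that by (auto simp: w_def restr_def cobd_Cons A_def x_def x0_def x1_def y_def)
    moreover from w_eq have "bd n (\<lambda>g. restr F (cobd (Suc n) c) (Star # g)) = bd n w"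
      by (rule bd_cong)
    ultimately have
      e0: "k * x0 f = lap n B x0 f - w f" and
      e1: "k * x1 f = lap n B x1 f + w f" and
      ey: "k * y f = lap n A y f - bd n (restr A x) f" if "f \<in> cube n" for f
      using Suc.prems(2)[of "C0 # f"] Suc.prems(2)[of "C1 # f"] Suc.prems(2)[of "Star # f"] that
      by (simp_all add: lap_def bd_Cons x0_def x1_def y_def w bd_linear)
    have es: "lap n B s f = k * s f" if "f \<in> cube n" for f
      using e0[OF that] e1[OF that] by (simp add: s_def lap_linear algebra_simps)
    have ex: "k * x f = lap n B x f + 2 * w f" if "f \<in> cube n" for f
      using e0[OF that] e1[OF that] by (simp add: x_def lap_linear algebra_simps)
    show ?thesis
    proof (cases "\<exists>f\<in>cube n. s f \<noteq> 0")
      case True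
      then show ?thesis using Suc.IH[OF shifted(2) es] by blast
    next
      case s0: False
      \<comment> \<open>Outside the link both \<open>lap n B x\<close> and \<open>w\<close> vanish, so \<open>k * x f = 0\<close>.\<close>
      have xA: "x f = 0" if "f \<in> cube n" "f \<notin> A" for f
      proof -
        have "of_int (inc f g) * restr B h g = 0" for g and h :: "face \<Rightarrow> 'a"
          using shifted_family_facet[OF Suc.prems(1) that(1), of g] that(2)
          by (auto simp: restr_def A_def B_def)
        then have "lap n B x f = 0" unfolding lap_def bd_def by (intro sum.neutral) blast
        then show ?thesis using ex[OF that(1)] that(2) False by (simp add: w_def restr_def)
      qed
      have bdA: "bd n (restr A x) = bd n x"
        by (intro bd_cong) (auto simp: restr_def xA)
      \<comment> \<open>Apply the boundary to \<open>ex\<close> and eliminate the boundary of \<open>x\<close> by \<open>ey\<close>.\<close>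
      have ey': "lap n A y f = (k - 2) * y f" if f: "f \<in> cube n" for f
      proof -
        have "k * bd n x f = bd n (\<lambda>f. k * x f) f" by (simp add: bd_linear)
        also have "\<dots> = bd n (\<lambda>f. lap n B x f + 2 * w f) f"
          by (rule fun_cong[OF bd_cong]) (rule ex)
        also have "\<dots> = 2 * (bd n x f - lap n A y f)"
          using bd_bd[OF f] by (simp add: bd_linear w bdA lap_def)
        finally have "k * bd n x f = 2 * (bd n x f - lap n A y f)" .
        moreover have "bd n x f = lap n A y f - k * y f"
          using ey[OF f] by (simp add: bdA)
        ultimately have "k * (lap n A y f - k * y f) = k * (- 2 * y f)"
          by (simp add: algebra_simps)
        then have "lap n A y f - k * y f = - 2 * y f"
          using False mult_left_cancel by blast
        then show ?thesis by (simp add: algebra_simps)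
      qed
      have "k - 2 \<in> \<int>"
      proof (cases "\<exists>f\<in>cube n. y f \<noteq> 0")
        case True
        then show ?thesis using Suc.IH[OF shifted(1) ey'] by blast
      next
        case y0: False
        then have "cobd n y g = 0" for g by (simp add: cobd_def)
        then have "w f = x f" if "f \<in> cube n" for f
          using xA[OF that] by (simp add: w_def restr_def)
        then have lapx: "lap n B x f = (k - 2) * x f" if "f \<in> cube n" for f
          using ex[OF that] that by (simp add: algebra_simps)
        have "\<exists>f\<in>cube n. x f \<noteq> 0"
        proof (rule ccontr)
          assume x0: "\<not> ?thesis"
          have "c f = 0" if "f \<in> cube (Suc n)" for f
            using that
          proof (cases rule: cube_Suc_cases)
            case (1 g)
            then have "x0 g + x1 g = 0" "x1 g = x0 g" using s0 x0 by (auto simp: s_def x_def)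
            then have "2 * x0 g = 0" by simp
            then show ?thesis using 1 by (simp add: x0_def)
          next
            case (2 g)
            then have "x0 g + x1 g = 0" "x1 g = x0 g" using s0 x0 by (auto simp: s_def x_def)
            then have "2 * x1 g = 0" by simp
            then show ?thesis using 2 by (simp add: x1_def)
          next
            case (3 g)
            then show ?thesis using y0 by (auto simp: y_def)
          qed
          then show False using Suc.prems(3) by blast
        qed
        then show ?thesis using Suc.IH[OF shifted(2) lapx] by blast
      qed
      then have "(k - 2) + 2 \<in> \<int>" by (rule Ints_add) simp
      then show ?thesis by simp
    qed
  qed simp
qed

section \<open>From operators to matrices\<close>

lemma eigenvalue_iff:
  assumes "M \<in> carrier_mat m m"
  shows "eigenvalue M k \<longleftrightarrow> (\<exists>v \<in> carrier_vec m. v \<noteq> 0\<^sub>v m \<and> M *\<^sub>v v = k \<cdot>\<^sub>v v)"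
  using assms by (auto simp: eigenvalue_def eigenvector_def)

text \<open>
  If \<open>v\<close> is an eigenvector of \<open>N * M\<close>, then \<open>M *\<^sub>v v\<close> is one of \<open>M * N\<close>; it is nonzero since
  \<open>N\<close> maps it to \<open>k \<cdot>\<^sub>v v\<close>.
\<close>

lemma eigenvalue_mult_swap:
  fixes M N :: "'a::field mat"
  assumes M: "M \<in> carrier_mat p q" and N: "N \<in> carrier_mat q p"
    and ev: "eigenvalue (N * M) k" and "k \<noteq> 0"
  shows "eigenvalue (M * N) k"
proof -
  obtain v where v: "v \<in> carrier_vec q" "v \<noteq> 0\<^sub>v q" and e: "N * M *\<^sub>v v = k \<cdot>\<^sub>v v"
    using ev M N by (auto simp: eigenvalue_iff[where m=q])
  have NMv: "N *\<^sub>v (M *\<^sub>v v) = k \<cdot>\<^sub>v v" using e M N v by (simp add: assoc_mult_mat_vec)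
  have Mv: "M *\<^sub>v v \<in> carrier_vec p" using M v by simp
  have "M *\<^sub>v v \<noteq> 0\<^sub>v p"
  proof
    assume "M *\<^sub>v v = 0\<^sub>v p"
    moreover have "N *\<^sub>v 0\<^sub>v p = 0\<^sub>v q" using N by (intro eq_vecI) auto
    ultimately have "k \<cdot>\<^sub>v v = 0\<^sub>v q" using NMv by simp
    then have "v = 0\<^sub>v q" using \<open>k \<noteq> 0\<close> v(1)
      by (intro eq_vecI) (auto dest!: arg_cong[where f="\<lambda>u. u $ _"] simp: vec_eq_iff)
    then show False using v by simp
  qed
  moreover have "M * N *\<^sub>v (M *\<^sub>v v) = k \<cdot>\<^sub>v (M *\<^sub>v v)"
    using NMv M N Mv v by (simp add: assoc_mult_mat_vec mult_mat_vec)
  ultimately show ?thesis using M N Mv by (auto simp: eigenvalue_iff[where m=p])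
qed

text \<open>
  For an eigenvector \<open>v\<close> of the sum, \<open>U *\<^sub>v v\<close> is an eigenvector of \<open>U\<close> unless it vanishes, and if
  it vanishes then \<open>v\<close> itself is an eigenvector of \<open>D\<close>.
\<close>

lemma eigenvalue_add_orthogonal:
  fixes U D :: "'a::field mat"
  assumes U: "U \<in> carrier_mat m m" and D: "D \<in> carrier_mat m m" and UD: "U * D = 0\<^sub>m m m"
    and ev: "eigenvalue (U + D) k"
  shows "eigenvalue U k \<or> eigenvalue D k"
proof -
  obtain v where v: "v \<in> carrier_vec m" "v \<noteq> 0\<^sub>v m" and e: "(U + D) *\<^sub>v v = k \<cdot>\<^sub>v v"
    using ev U D by (auto simp: eigenvalue_iff[where m=m])
  have e': "U *\<^sub>v v + D *\<^sub>v v = k \<cdot>\<^sub>v v" using e U D v by (simp add: add_mult_distrib_mat_vec)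
  show ?thesis
  proof (cases "U *\<^sub>v v = 0\<^sub>v m")
    case True
    then have "D *\<^sub>v v = k \<cdot>\<^sub>v v" using e' D v by simp
    then show ?thesis using D v by (auto simp: eigenvalue_iff[where m=m])
  next
    case False
    have "U *\<^sub>v (D *\<^sub>v v) = 0\<^sub>v m"
      using UD U D v by (auto simp flip: assoc_mult_mat_vec)
    then have "U *\<^sub>v (U *\<^sub>v v) = U *\<^sub>v (U *\<^sub>v v + D *\<^sub>v v)"
      using U D v by (simp add: mult_add_distrib_mat_vec)
    also have "\<dots> = k \<cdot>\<^sub>v (U *\<^sub>v v)" using e' U v by (simp add: mult_mat_vec)
    finally show ?thesis using False U v by (auto simp: eigenvalue_iff[where m=m])
  qed
qed

lemma sum_face_list:
  assumes "proper_cubical_complex n X"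
  shows "(\<Sum>r<length (face_list n X i). h (face_list n X i ! r)) =
         (\<Sum>f\<in>{f \<in> X. face_dim f = i}. h f)"
proof -
  have "bij_betw ((!) (face_list n X i)) {..<length (face_list n X i)} {f \<in> X. face_dim f = i}"
    by (intro bij_betw_nth distinct_face_list) (simp_all add: set_face_list assms)
  then show ?thesis by (rule sum.reindex_bij_betw)
qed

declare boundary_mat.simps(2) [simp del]

lemma dim_boundary_mat [simp]:
  "dim_row (boundary_mat n X (Suc i)) = length (face_list n X i)"
  "dim_col (boundary_mat n X i) = length (face_list n X i)"
  by (simp add: boundary_mat.simps(2)) (cases i; simp add: boundary_mat.simps(2))

lemma boundary_mat_entry:
  assumes X: "proper_cubical_complex n X"
    and r: "r < length (face_list n X i)" and q: "q < length (face_list n X (Suc i))"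
  shows "boundary_mat n X (Suc i) $$ (r, q) =
           of_int (inc (face_list n X i ! r) (face_list n X (Suc i) ! q))"
proof -
  have "face_list n X i ! r \<in> X \<and> face_dim (face_list n X i ! r) = i"
    "face_list n X (Suc i) ! q \<in> X \<and> face_dim (face_list n X (Suc i) ! q) = Suc i"
    using nth_mem[OF r] nth_mem[OF q] X by (simp_all add: set_face_list)
  moreover have "length f = n" if "f \<in> X" for f
    using that X by (auto simp: proper_cubical_complex_def cube_def)
  ultimately show ?thesis using r q 
    using X by (simp add: boundary_mat.simps(2) incidence_eq_inc)
qed

text \<open>
  A complex contains the facets of its faces. Hence sums over the cube against incidence numbers
  with a face of \<open>X\<close> may be restricted to \<open>X\<close>, so that the operators on the cube and the
  matrices of \<open>X\<close> agree.
\<close>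

lemma proper_facet:
  assumes "proper_cubical_complex n X" "g \<in> X" "inc f g \<noteq> 0"
  shows "f \<in> X \<and> face_dim g = Suc (face_dim f)"
proof -
  have "face_le f g" "face_dim g = Suc (face_dim f)" using inc_nonzeroD[OF assms(3)] by auto
  moreover from this have "f \<in> cube n"
    using assms face_le_length[of f g] by (auto simp: proper_cubical_complex_def cube_def)
  ultimately show ?thesis using assms by (auto simp: proper_cubical_complex_def)
qed

text \<open>
  An eigenvector of the matrix, extended by zero to the cube, is an eigenvector of \<open>lap\<close>: on faces
  outside the complex or of another dimension, \<open>lap\<close> has value zero as well.
\<close>

lemma laplacian_ud_integral:
  fixes k :: "'a::{field,ring_char_0}"
  assumes X: "proper_cubical_complex n X"
    and shifted: "shifted_family n {g \<in> X. face_dim g = Suc i}"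
    and ev: "eigenvalue (laplacian_ud n X i) k"
  shows "k \<in> \<int>"
proof -
  define Fi where "Fi = face_list n X i"
  define Xi Xj where "Xi = {f \<in> X. face_dim f = i}" and "Xj = {g \<in> X. face_dim g = Suc i}"
  define M where "M = (boundary_mat n X (Suc i) :: 'a mat)"
  have sub: "Xi \<subseteq> cube n" "Xj \<subseteq> cube n"
    using X by (auto simp: Xi_def Xj_def proper_cubical_complex_def)
  have setFi: "set Fi = Xi" using X by (simp add: Fi_def Xi_def set_face_list)
  have M: "M \<in> carrier_mat (length Fi) (length (face_list n X (Suc i)))"
    by (intro carrier_matI) (simp_all add: M_def Fi_def)
  have M_entry: "M $$ (r, q) = of_int (inc (Fi ! r) (face_list n X (Suc i) ! q))"
    if "r < length Fi" "q < length (face_list n X (Suc i))" for r q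
    using that by (simp add: M_def Fi_def boundary_mat_entry[OF X])
  have L: "laplacian_ud n X i = M * transpose_mat M" by (simp add: laplacian_ud_def M_def)
  obtain v where v: "v \<in> carrier_vec (length Fi)" "v \<noteq> 0\<^sub>v (length Fi)"
    and e: "M * transpose_mat M *\<^sub>v v = k \<cdot>\<^sub>v v"
    using ev M unfolding L by (auto simp: eigenvalue_iff[where m="length Fi"])
  \<comment> \<open>The extension by zero of \<open>v\<close>; as the list of faces is distinct, at most one term survives.\<close>
  define c where "c f = (\<Sum>r<length Fi. if Fi ! r = f then v $ r else 0)" for f
  have c_nth: "c (Fi ! r) = v $ r" if r: "r < length Fi" for r
  proof -
    have "c (Fi ! r) = (\<Sum>q<length Fi. if q = r then v $ q else 0)"
      unfolding c_def using r
      by (intro sum.cong) (auto simp: Fi_def nth_eq_iff_index_eq distinct_face_list)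
    then show ?thesis using r by simp
  qed
  have c_out: "c f = 0" if "f \<notin> Xi" for f
    using that setFi by (auto simp: c_def intro!: sum.neutral)
  have Mt: "(transpose_mat M *\<^sub>v v) $ q = cobd n c (face_list n X (Suc i) ! q)"
    if q: "q < length (face_list n X (Suc i))" for q
  proof -
    let ?g = "face_list n X (Suc i) ! q"
    have "(transpose_mat M *\<^sub>v v) $ q = (\<Sum>r<length Fi. M $$ (r, q) * v $ r)"
      using M v q by (simp add: scalar_prod_def lessThan_atLeast0)
    also have "\<dots> = (\<Sum>r<length Fi. of_int (inc (Fi ! r) ?g) * c (Fi ! r))"
      using q by (intro sum.cong) (simp_all add: M_entry c_nth)
    also have "\<dots> = (\<Sum>f\<in>Xi. of_int (inc f ?g) * c f)"
      unfolding Fi_def Xi_def by (rule sum_face_list[OF X])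
    also have "\<dots> = cobd n c ?g"
      unfolding cobd_def using sub by (intro sum.mono_neutral_left) (auto simp: c_out)
    finally show ?thesis .
  qed
  have MMt: "(M * transpose_mat M *\<^sub>v v) $ r = lap n Xj c (Fi ! r)" if r: "r < length Fi" for r
  proof -
    let ?f = "Fi ! r" and ?Fj = "face_list n X (Suc i)"
    have "(M * transpose_mat M *\<^sub>v v) $ r = (M *\<^sub>v (transpose_mat M *\<^sub>v v)) $ r"
      using M v by (simp add: assoc_mult_mat_vec[where A=M])
    also have "\<dots> = (\<Sum>q<length ?Fj. M $$ (r, q) * (transpose_mat M *\<^sub>v v) $ q)"
      using M v r by (simp add: scalar_prod_def lessThan_atLeast0)
    also have "\<dots> = (\<Sum>q<length ?Fj. of_int (inc ?f (?Fj ! q)) * cobd n c (?Fj ! q))"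
      using r by (intro sum.cong) (simp_all only: Mt M_entry lessThan_iff)
    also have "\<dots> = (\<Sum>g\<in>Xj. of_int (inc ?f g) * cobd n c g)"
      unfolding Xj_def by (rule sum_face_list[OF X])
    also have "\<dots> = (\<Sum>g\<in>Xj. of_int (inc ?f g) * restr Xj (cobd n c) g)"
      by (intro sum.cong) (auto simp: restr_def)
    also have "\<dots> = lap n Xj c ?f"
      unfolding lap_def bd_def using sub by (intro sum.mono_neutral_left) (auto simp: restr_def)
    finally show ?thesis .
  qed
  have "lap n Xj c f = k * c f" for f
  proof (cases "f \<in> Xi")
    case True
    then obtain r where r: "r < length Fi" "f = Fi ! r" using setFi by (metis in_set_conv_nth)
    then show ?thesis using MMt[OF r(1)] v by (simp add: e c_nth)
  next
    case False
    have "of_int (inc f g) * restr Xj h g = 0" for g and h :: "face \<Rightarrow> 'a"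
      using False proper_facet[OF X, of g f]
      by (cases "inc f g = 0") (auto simp: restr_def Xi_def Xj_def)
    then have "lap n Xj c f = 0" unfolding lap_def bd_def by (intro sum.neutral) blast
    then show ?thesis using False by (simp add: c_out)
  qed
  moreover have "\<exists>f\<in>cube n. c f \<noteq> 0"
  proof -
    obtain r where r: "r < length Fi" "v $ r \<noteq> 0"
      using v by (metis carrier_vecD eq_vecI index_zero_vec)
    then show ?thesis using c_nth[OF r(1)] sub setFi nth_mem[OF r(1)]
      by (intro bexI[of _ "Fi ! r"]) auto
  qed
  ultimately show ?thesis
    using shifted unfolding Xj_def by (intro lap_eigenvalue_integral)
qed

lemma boundary_mat_mult_boundary_mat:
  assumes X: "proper_cubical_complex n X"
  shows "(boundary_mat n X i * boundary_mat n X (Suc i) :: 'a mat) =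
    0\<^sub>m (dim_row (boundary_mat n X i :: 'a::comm_ring_1 mat)) (length (face_list n X (Suc i)))"
    (is "?L = ?R")
proof (cases i)
  case 0
  then show ?thesis by (intro eq_matI) auto
next
  case (Suc j)
  show ?thesis
  proof (rule eq_matI)
    fix r q assume "r < dim_row ?R" "q < dim_col ?R"
    then have r: "r < length (face_list n X j)" and q: "q < length (face_list n X (Suc i))"
      by (simp_all add: Suc)
    let ?f = "face_list n X j ! r" and ?h = "face_list n X (Suc i) ! q"
    \<comment> \<open>The chain of the single face \<open>?h\<close>; the entry is the coefficient of \<open>?f\<close> in its double
      boundary.\<close>
    define \<delta> :: "face \<Rightarrow> 'a" where "\<delta> g = (if g = ?h then 1 else 0)" for g
    have fh: "?f \<in> cube n" "?h \<in> cube n" "?h \<in> X" "face_dim ?h = Suc i"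
      using nth_mem[OF r] nth_mem[OF q] X
      by (auto simp: set_face_list proper_cubical_complex_def)
    have \<delta>: "bd n \<delta> g = of_int (inc g ?h)" for g
      using fh(2) by (simp add: bd_def \<delta>_def if_distrib cong: if_cong)
    have "?L $$ (r, q) = (\<Sum>p<length (face_list n X i).
        boundary_mat n X i $$ (r, p) * boundary_mat n X (Suc i) $$ (p, q))"
      using r q by (simp add: scalar_prod_def lessThan_atLeast0 Suc)
    also have "\<dots> = (\<Sum>p<length (face_list n X i). of_int (inc ?f (face_list n X i ! p)) *
        of_int (inc (face_list n X i ! p) ?h))"
      using r q by (intro sum.cong)
        (auto simp: Suc boundary_mat_entry[OF X])
    also have "\<dots> = (\<Sum>g\<in>{g \<in> X. face_dim g = i}. of_int (inc ?f g) * of_int (inc g ?h))"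
      by (rule sum_face_list[OF X])
    also have "\<dots> = bd n (bd n \<delta>) ?f"
    proof -
      have "of_int (inc g ?h) = (0 :: 'a)" if "g \<notin> {g \<in> X. face_dim g = i}" for g
        using that proper_facet[OF X fh(3), of g] fh(4) by (cases "inc g ?h = 0") auto
      then show ?thesis
        unfolding bd_def[of n "bd n \<delta>"] \<delta> using X
        by (intro sum.mono_neutral_left) (auto simp: proper_cubical_complex_def)
    qed
    also have "\<dots> = 0" using fh by (intro bd_bd)
    finally show "?L $$ (r, q) = ?R $$ (r, q)" using r q by (simp add: Suc)
  qed (simp_all add: Suc)
qed

lemma shifted_complex_shifted_family:
  assumes "shifted_cubical_complex n X"
  shows "shifted_family n {g \<in> X. face_dim g = d}"
  unfolding shifted_family_def
proof (intro ballI impI)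
  fix f g assume f: "f \<in> cube n" and g: "g \<in> {g \<in> X. face_dim g = d}"
    and p: "precedes (dir f) (dir g)"
  have "length (sorted_list_of_set (dir f)) = length (sorted_list_of_set (dir g))"
    using p unfolding precedes_def by (rule list_all2_lengthD)
  then have "face_dim f = face_dim g" by (simp add: face_dim_def)
  moreover have "g \<in> cube n"
    using g assms by (auto simp: shifted_cubical_complex_def proper_cubical_complex_def)
  moreover have "\<forall>f\<in>cube n. \<forall>g\<in>cube n. face_dim f = face_dim g \<longrightarrow>
      g \<in> X \<longrightarrow> precedes (dir f) (dir g) \<longrightarrow> f \<in> X"
    using assms unfolding shifted_cubical_complex_def by (elim conjE)
  ultimately show "f \<in> {g \<in> X. face_dim g = d}"
    using f g p by blast
qed

theorem corollary5p5:
  fixes n :: nat and X :: "face set"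
  assumes "shifted_cubical_complex n X"
  shows "laplacian_integral n X"
proof -
  have X: "proper_cubical_complex n X" using assms by (simp add: shifted_cubical_complex_def)
  have ud: "k \<in> \<int>" if "eigenvalue (laplacian_ud n X i) k" for i and k :: complex
    using laplacian_ud_integral[OF X shifted_complex_shifted_family[OF assms] that] .
  \<comment> \<open>In dimension 0 the boundary matrix has no rows, so the down-up Laplacian is zero.\<close>
  have du: "k \<in> \<int>" if ev: "eigenvalue (laplacian_du n X i) k" for i and k :: complex
  proof (cases i)
    case 0
    let ?m = "length (face_list n X 0)"
    have z: "laplacian_du n X i = (0\<^sub>m ?m ?m :: complex mat)"
      unfolding 0 laplacian_du_def by (intro eq_matI) (auto simp: scalar_prod_def)
    obtain v :: "complex vec" where v: "v \<in> carrier_vec ?m" "v \<noteq> 0\<^sub>v ?m" "0\<^sub>m ?m ?m *\<^sub>v v = k \<cdot>\<^sub>v v"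
      using ev unfolding z by (auto simp: eigenvalue_iff[where m="?m"])
    obtain r where r: "r < ?m" "v $ r \<noteq> 0" using v by (metis carrier_vecD eq_vecI index_zero_vec)
    have "(k \<cdot>\<^sub>v v) $ r = 0" using r v(1) by (simp flip: v(3))
    then show ?thesis using r v by simp
  next
    case (Suc j)
    show ?thesis
    proof (cases "k = 0")
      case False
      define M where "M = (boundary_mat n X i :: complex mat)"
      have "M \<in> carrier_mat (dim_row M) (dim_col M)" by simp
      moreover have "eigenvalue (transpose_mat M * M) k"
        using ev by (simp add: laplacian_du_def M_def)
      ultimately have "eigenvalue (M * transpose_mat M) k"
        using False by (intro eigenvalue_mult_swap[of M _ _ "transpose_mat M"]) auto
      then show ?thesis using ud[of j k] by (simp add: laplacian_ud_def M_def Suc)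
    qed simp
  qed
  have tot: "k \<in> \<int>" if ev: "eigenvalue (laplacian_tot n X i) k" for i and k :: complex
  proof -
    let ?m = "length (face_list n X i)"
    define M N where "M = (boundary_mat n X i :: complex mat)"
      and "N = (boundary_mat n X (Suc i) :: complex mat)"
    have M: "M \<in> carrier_mat (dim_row M) ?m" and N: "N \<in> carrier_mat ?m (dim_col N)"
      by (auto simp: M_def N_def)
    have "transpose_mat N * transpose_mat M = transpose_mat (M * N)"
      using M N by (simp add: transpose_mult)
    also have "M * N = 0\<^sub>m (dim_row M) (dim_col N)"
      using boundary_mat_mult_boundary_mat[OF X, of i, where 'a=complex] by (simp add: M_def N_def)
    finally have NM: "transpose_mat N * transpose_mat M = 0\<^sub>m (dim_col N) (dim_row M)" by simp
    have T: "transpose_mat N \<in> carrier_mat (dim_col N) ?m"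
      "transpose_mat M \<in> carrier_mat ?m (dim_row M)"
      using N M by (simp_all only: transpose_carrier_mat)
    have "N * transpose_mat N * (transpose_mat M * M) =
        N * (transpose_mat N * (transpose_mat M * M))"
      by (rule assoc_mult_mat[OF N T(1) mult_carrier_mat[OF T(2) M]])
    also have "transpose_mat N * (transpose_mat M * M) = transpose_mat N * transpose_mat M * M"
      by (rule assoc_mult_mat[OF T M, symmetric])
    also have "N * \<dots> = 0\<^sub>m ?m ?m"
      unfolding NM using left_mult_zero_mat[OF M] right_mult_zero_mat[OF N] by simp
    finally have "N * transpose_mat N * (transpose_mat M * M) = 0\<^sub>m ?m ?m" .
    moreover have "eigenvalue (N * transpose_mat N + transpose_mat M * M) k"
      using ev by (simp add: laplacian_tot_def laplacian_ud_def laplacian_du_def M_def N_def)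
    ultimately have "eigenvalue (N * transpose_mat N) k \<or> eigenvalue (transpose_mat M * M) k"
      using mult_carrier_mat[OF N T(1)] mult_carrier_mat[OF T(2) M]
      by (intro eigenvalue_add_orthogonal)
    then show ?thesis using ud[of i k] du[of i k]
      by (auto simp: laplacian_ud_def laplacian_du_def M_def N_def)
  qed
  show ?thesis unfolding laplacian_integral_def using ud du tot by blast
qed

end
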